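(* Let $X$ be a nonempty set and let $F\colon X^2\to X$ be an operation. The following assertions are equivalent. (i) $F$ is $(1,3)$-selective. (ii) $F(x,y)=F(u,v)\in[x]_{\sim_F}$ for all $x,y\in X$, $u\in[x]_{\sim_F}$, and $v\in[y]_{\sim_F}$. (iii) $F(F(x,y),z)=F(x,z)$ and $F(x,F(y,z))=F(x,y)$ for all $x,y,z\in X$.
   Context: An operation $F\colon X^2\to X$ is $(1,3)$-selective if $F(F(x_1,x_2),F(x_3,x_4))=F(x_1,x_3)$ for all $x_1,x_2,x_3,x_4\in X$. The equivalence relation $\sim_F$ on $X$ is defined by $x\sim_F y$ if and only if $F(x,x)=F(y,y)$, and $[x]_{\sim_F}$ denotes the equivalence class of $x$. *)

theory Defs
  imports "HOL-Library.FuncSet"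
begin

definition selective13 :: "'a set \<Rightarrow> ('a \<times> 'a \<Rightarrow> 'a) \<Rightarrow> bool" where
  "selective13 X F \<longleftrightarrow>
     (\<forall>x1\<in>X. \<forall>x2\<in>X. \<forall>x3\<in>X. \<forall>x4\<in>X. F (F (x1, x2), F (x3, x4)) = F (x1, x3))"

text \<open>The equivalence class of \<open>x\<close> is the library's relational image \<open>sim_rel X F `` {x}\<close>.\<close>

definition sim_rel :: "'a set \<Rightarrow> ('a \<times> 'a \<Rightarrow> 'a) \<Rightarrow> ('a \<times> 'a) set" where
  "sim_rel X F = {(x, y). x \<in> X \<and> y \<in> X \<and> F (x, x) = F (y, y)}"

lemma equiv_sim_rel: "equiv X (sim_rel X F)"
  by (rule equivI) (auto simp: sim_rel_def refl_on_def sym_def trans_def)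

end

theory Submission
  imports Defs
begin

text \<open>The three conditions are linked in a cycle. Selectivity gives F(x,y) = F(F(x,x),F(y,y)),
  so a value of F depends only on the diagonal values of its arguments, that is, on their classes.
  Conversely, if F respects classes and F(x,y) stays in the class of x, then a nested product may be
  replaced by its left factor; doing this in both arguments recovers selectivity.\<close>

theorem theorem3p1:
  fixes X :: "'a set" and F :: "'a \<times> 'a \<Rightarrow> 'a"
  assumes "X \<noteq> {}" and "F \<in> X \<times> X \<rightarrow> X"
  shows "(selective13 X F \<longleftrightarrow>
            (\<forall>x\<in>X. \<forall>y\<in>X. \<forall>u\<in>sim_rel X F `` {x}. \<forall>v\<in>sim_rel X F `` {y}.
               F (x, y) = F (u, v) \<and> F (u, v) \<in> sim_rel X F `` {x}))
       \<and> ((\<forall>x\<in>X. \<forall>y\<in>X. \<forall>u\<in>sim_rel X F `` {x}. \<forall>v\<in>sim_rel X F `` {y}.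
               F (x, y) = F (u, v) \<and> F (u, v) \<in> sim_rel X F `` {x}) \<longleftrightarrow>
            (\<forall>x\<in>X. \<forall>y\<in>X. \<forall>z\<in>X.
               F (F (x, y), z) = F (x, z) \<and> F (x, F (y, z)) = F (x, y)))"
proof -
  let ?sel = "selective13 X F"
  let ?cls = "\<forall>x\<in>X. \<forall>y\<in>X. \<forall>u\<in>sim_rel X F `` {x}. \<forall>v\<in>sim_rel X F `` {y}.
               F (x, y) = F (u, v) \<and> F (u, v) \<in> sim_rel X F `` {x}"
  let ?red = "\<forall>x\<in>X. \<forall>y\<in>X. \<forall>z\<in>X.
               F (F (x, y), z) = F (x, z) \<and> F (x, F (y, z)) = F (x, y)"
  have closed: "F (x, y) \<in> X" if "x \<in> X" "y \<in> X" for x y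
    using assms(2) that by auto
  have "?cls" if sel: "?sel"
  proof (intro ballI)
    fix x y u v
    assume xy: "x \<in> X" "y \<in> X" and "u \<in> sim_rel X F `` {x}" "v \<in> sim_rel X F `` {y}"
    then have uv: "u \<in> X" "v \<in> X" "F (u, u) = F (x, x)" "F (v, v) = F (y, y)"
      by (simp_all add: sim_rel_def)
    have S: "F (F (a, b), F (c, d)) = F (a, c)"
      if "a \<in> X" "b \<in> X" "c \<in> X" "d \<in> X" for a b c d
      using sel that unfolding selective13_def by blast
    have "F (x, y) = F (F (x, x), F (y, y))"
      using S xy by simp
    also have "\<dots> = F (F (u, u), F (v, v))"
      using uv by simp
    also have "\<dots> = F (u, v)"
      using S uv(1,2) by simp
    finally have "F (x, y) = F (u, v)" .
    \<comment> \<open>\<open>S\<close> at \<open>c = a = x\<close>, \<open>d = b = y\<close> reads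
      F(F(x,y),F(x,y)) = F(x,x).\<close>
    moreover have "F (x, y) \<in> sim_rel X F `` {x}"
      using S xy closed by (simp add: sim_rel_def)
    ultimately show "F (x, y) = F (u, v) \<and> F (u, v) \<in> sim_rel X F `` {x}"
      by simp
  qed
  moreover have "?red" if cls: "?cls"
  proof -
    have self: "x \<in> sim_rel X F `` {x}" if "x \<in> X" for x
      using that by (simp add: sim_rel_def)
    \<comment> \<open>Take \<open>u = x\<close> and \<open>v = y\<close> in \<open>?cls\<close>. A
      product is thus another representative of the class of its left factor, and
      \<open>?cls\<close> allows the exchange in either argument.\<close>
    have "F (x, y) \<in> sim_rel X F `` {x}" if "x \<in> X" "y \<in> X" for x y
      using cls self that by blast
    then show ?thesis
      using cls self by metis
  qed
  \<comment> \<open>F(F(x1,x2),F(x3,x4)) = F(x1,F(x3,x4)) = F(x1,x3); \<open>closed\<close> lets the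
    inner product serve as an argument in \<open>?red\<close>.\<close>
  moreover have "?sel" if "?red"
    using that closed by (simp add: selective13_def)
  ultimately show ?thesis
    by blast
qed

end
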